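(* Let $m\ge1$, let $P(z)\in\mathbb{K}[z]$ be a polynomial of degree $d\geq 2$, and let $k_1,\dots,k_m$ be integers with $k_i\geq 2$ for all $i$. Then the variety $Y=\{y_1^{k_1}\cdots y_m^{k_m}=P(z)\}\subset\mathbb{K}^{m+1}$ is rigid.
   Context: $\mathbb{K}$ is an algebraically closed field of characteristic zero. A derivation $\partial$ of a commutative $\mathbb{K}$-algebra $A$ is locally nilpotent if for every $a\in A$ there is $n$ with $\partial^n(a)=0$. An affine variety $Y$ (possibly reducible) is rigid if its algebra of regular functions $\mathbb{K}[Y]$ admits no nonzero locally nilpotent derivation. *)

theory Defs
  imports
    "HOL-Algebra.Module"
    "HOL-Algebra.Algebraic_Closure_Type"
    "HOL-Computational_Algebra.Polynomial"
begin

(* The points of K^n are the families (x 1, ..., x n), undefined outside the indices 1..n. *)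
definition affine_space :: "nat \<Rightarrow> (nat \<Rightarrow> 'k) set" where
  "affine_space n = {1..n} \<rightarrow>\<^sub>E UNIV"

(* For a Zariski closed subset Y of K^n the regular functions on Y are exactly the restrictions
   to Y of polynomial functions in n variables.  Functions on Y are undefined outside Y, so that
   equality in K[Y] is equality of functions on Y. *)
definition regular_functions :: "nat \<Rightarrow> (nat \<Rightarrow> 'k::field) set \<Rightarrow> ((nat \<Rightarrow> 'k) \<Rightarrow> 'k) set" where
  "regular_functions n Y =
    {(\<lambda>x\<in>Y. \<Sum>\<alpha>\<in>S. c \<alpha> * (\<Prod>i=1..n. x i ^ \<alpha> i)) | (S :: (nat \<Rightarrow> nat) set) c. finite S}"

definition regular_algebra ::
    "nat \<Rightarrow> (nat \<Rightarrow> 'k::field) set \<Rightarrow> ('k, (nat \<Rightarrow> 'k) \<Rightarrow> 'k) module" where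
  "regular_algebra n Y =
    \<lparr>carrier = regular_functions n Y,
     monoid.mult = (\<lambda>f g. \<lambda>x\<in>Y. f x * g x),
     monoid.one = (\<lambda>x\<in>Y. 1),
     ring.zero = (\<lambda>x\<in>Y. 0),
     ring.add = (\<lambda>f g. \<lambda>x\<in>Y. f x + g x),
     module.smult = (\<lambda>c f. \<lambda>x\<in>Y. c * f x)\<rparr>"

lemma regular_functions_sumI:
  fixes a :: "'i \<Rightarrow> 'k::field" and e :: "'i \<Rightarrow> nat \<Rightarrow> nat"
  assumes "finite I"
  shows "(\<lambda>x\<in>Y. \<Sum>j\<in>I. a j * (\<Prod>i=1..n. x i ^ e j i)) \<in> regular_functions n Y"
proof -
  have "(\<Sum>j\<in>I. a j * (\<Prod>i=1..n. x i ^ e j i)) =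
        (\<Sum>\<alpha>\<in>e ` I. (\<Sum>j\<in>{j\<in>I. e j = \<alpha>}. a j) * (\<Prod>i=1..n. x i ^ \<alpha> i))" for x
    by (subst sum.image_gen[OF assms, of _ e]) (auto intro!: sum.cong simp: sum_distrib_right)
  with assms show ?thesis
    unfolding regular_functions_def
    by (intro CollectI exI[of _ "e ` I"] exI[of _ "\<lambda>\<alpha>. \<Sum>j\<in>{j\<in>I. e j = \<alpha>}. a j"]) simp
qed

lemma regular_functionsE:
  assumes "f \<in> regular_functions n Y"
  obtains S c where "finite S" "f = (\<lambda>x\<in>Y. \<Sum>\<alpha>\<in>S. c \<alpha> * (\<Prod>i=1..n. x i ^ \<alpha> i))"
  using assms unfolding regular_functions_def by blast

lemma regular_functions_const: "(\<lambda>x\<in>Y. c) \<in> regular_functions n Y"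
  using regular_functions_sumI[where I = "{()}" and Y = Y and a = "\<lambda>_. c" and n = n and e = "\<lambda>_ _. 0"] by simp

lemma regular_functions_add:
  assumes "f \<in> regular_functions n Y" "g \<in> regular_functions n Y"
  shows "(\<lambda>x\<in>Y. f x + g x) \<in> regular_functions n Y"
proof -
  obtain S c where S: "finite S" "f = (\<lambda>x\<in>Y. \<Sum>\<alpha>\<in>S. c \<alpha> * (\<Prod>i=1..n. x i ^ \<alpha> i))"
    using assms(1) by (rule regular_functionsE)
  obtain T d where T: "finite T" "g = (\<lambda>x\<in>Y. \<Sum>\<alpha>\<in>T. d \<alpha> * (\<Prod>i=1..n. x i ^ \<alpha> i))"
    using assms(2) by (rule regular_functionsE)
  have "(\<lambda>x\<in>Y. f x + g x) =
      (\<lambda>x\<in>Y. \<Sum>j\<in>S <+> T. case_sum c d j * (\<Prod>i=1..n. x i ^ case_sum id id j i))"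
    using S T by (auto simp: restrict_def sum.Plus fun_eq_iff)
  with S T show ?thesis
    using regular_functions_sumI[where I = "S <+> T" and Y = Y and a = "case_sum c d" and n = n
        and e = "case_sum id id"] by simp
qed

lemma regular_functions_mult:
  assumes "f \<in> regular_functions n Y" "g \<in> regular_functions n Y"
  shows "(\<lambda>x\<in>Y. f x * g x) \<in> regular_functions n Y"
proof -
  obtain S c where S: "finite S" "f = (\<lambda>x\<in>Y. \<Sum>\<alpha>\<in>S. c \<alpha> * (\<Prod>i=1..n. x i ^ \<alpha> i))"
    using assms(1) by (rule regular_functionsE)
  obtain T d where T: "finite T" "g = (\<lambda>x\<in>Y. \<Sum>\<alpha>\<in>T. d \<alpha> * (\<Prod>i=1..n. x i ^ \<alpha> i))"
    using assms(2) by (rule regular_functionsE)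
  have "(\<lambda>x\<in>Y. f x * g x) =
      (\<lambda>x\<in>Y. \<Sum>j\<in>S \<times> T. (c (fst j) * d (snd j)) * (\<Prod>i=1..n. x i ^ (fst j i + snd j i)))"
    using S T by (auto simp: restrict_def sum_product sum.cartesian_product fun_eq_iff
        power_add prod.distrib mult_ac intro!: sum.cong)
  with S T show ?thesis
    using regular_functions_sumI[where I = "S \<times> T" and Y = Y
        and a = "\<lambda>j. c (fst j) * d (snd j)" and n = n and e = "\<lambda>j i. fst j i + snd j i"] by simp
qed

lemma regular_functions_coord:
  assumes "j \<in> {1..n}"
  shows "(\<lambda>x\<in>Y. x j) \<in> regular_functions n Y"
proof -
  have "(\<Prod>i=1..n. x i ^ (if i = j then 1 else 0)) = x j" for x :: "nat \<Rightarrow> 'a::field"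
    using assms by (subst prod.remove[of _ j]) auto
  then show ?thesis
    using regular_functions_sumI[where I = "{()}" and Y = Y and a = "\<lambda>_. 1" and n = n
        and e = "\<lambda>_ i. if i = j then 1 else 0"] by simp
qed

lemma regular_functions_extensional: "f \<in> regular_functions n Y \<Longrightarrow> f \<in> extensional Y"
  by (auto simp: regular_functions_def)

lemma algebra_regular_algebra:
  fixes Y :: "(nat \<Rightarrow> 'k::field) set"
  shows "algebra (ring_of_type_algebra :: 'k ring) (regular_algebra n Y)"
proof -
  have ext: "(\<lambda>x\<in>Y. f x) = f" if "f \<in> regular_functions n Y" for f
    using regular_functions_extensional[OF that] by (rule extensional_restrict)
  have smult: "(\<lambda>x\<in>Y. c * f x) \<in> regular_functions n Y"
    if "f \<in> regular_functions n Y" for c f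
  proof -
    have "(\<lambda>x\<in>Y. c * f x) = (\<lambda>x\<in>Y. (\<lambda>x\<in>Y. c) x * f x)"
      by (auto simp: restrict_def)
    then show ?thesis
      using regular_functions_mult[OF regular_functions_const that] by simp
  qed
  have uminus: "\<exists>g\<in>regular_functions n Y. (\<lambda>x\<in>Y. g x + f x) = (\<lambda>x\<in>Y. 0)"
    if "f \<in> regular_functions n Y" for f
    using smult[OF that, of "-1"] by (intro bexI[of _ "\<lambda>x\<in>Y. (-1) * f x"]) (auto simp: restrict_def)
  have group: "abelian_group (regular_algebra n Y)"
    by (rule abelian_groupI)
      (use uminus in \<open>auto simp: regular_algebra_def regular_functions_add regular_functions_const
         ext algebra_simps cong: restrict_cong\<close>)
  have monoid: "comm_monoid (regular_algebra n Y)"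
    by (rule comm_monoidI)
      (auto simp: regular_algebra_def regular_functions_mult regular_functions_const
         ext algebra_simps cong: restrict_cong)
  have "cring (regular_algebra n Y)"
    by (rule cringI[OF group monoid])
      (auto simp: regular_algebra_def algebra_simps cong: restrict_cong)
  then show ?thesis
    by (intro algebraI cring_from_type_algebra)
      (auto simp: regular_algebra_def ring_of_type_algebra_def smult ext algebra_simps
         cong: restrict_cong)
qed

(* The scalars of the algebra A are all elements of the field type 'k.  Only the values of D on
   the carrier of A matter. *)
definition derivation :: "('k::field, 'a, 'm) module_scheme \<Rightarrow> ('a \<Rightarrow> 'a) \<Rightarrow> bool" where
  "derivation A D \<longleftrightarrow>
    D \<in> carrier A \<rightarrow> carrier A \<and>
    (\<forall>a\<in>carrier A. \<forall>b\<in>carrier A. D (a \<oplus>\<^bsub>A\<^esub> b) = D a \<oplus>\<^bsub>A\<^esub> D b) \<and>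
    (\<forall>c. \<forall>a\<in>carrier A. D (c \<odot>\<^bsub>A\<^esub> a) = c \<odot>\<^bsub>A\<^esub> D a) \<and>
    (\<forall>a\<in>carrier A. \<forall>b\<in>carrier A.
      D (a \<otimes>\<^bsub>A\<^esub> b) = (D a \<otimes>\<^bsub>A\<^esub> b) \<oplus>\<^bsub>A\<^esub> (a \<otimes>\<^bsub>A\<^esub> D b))"

definition locally_nilpotent :: "('k, 'a, 'm) module_scheme \<Rightarrow> ('a \<Rightarrow> 'a) \<Rightarrow> bool" where
  "locally_nilpotent A D \<longleftrightarrow> (\<forall>a\<in>carrier A. \<exists>n. (D ^^ n) a = \<zero>\<^bsub>A\<^esub>)"

definition rigid :: "nat \<Rightarrow> (nat \<Rightarrow> 'k::field) set \<Rightarrow> bool" where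
  "rigid n Y \<longleftrightarrow>
    \<not> (\<exists>D. derivation (regular_algebra n Y) D \<and> locally_nilpotent (regular_algebra n Y) D \<and>
          (\<exists>f\<in>carrier (regular_algebra n Y). D f \<noteq> \<zero>\<^bsub>regular_algebra n Y\<^esub>))"

(* The coordinates of K^(m+1) are (y_1, ..., y_m, z), so z is the coordinate with index m+1. *)
definition power_product_variety :: "nat \<Rightarrow> (nat \<Rightarrow> nat) \<Rightarrow> 'k::field poly \<Rightarrow> (nat \<Rightarrow> 'k) set" where
  "power_product_variety m k P =
    {x \<in> affine_space (m + 1). (\<Prod>i=1..m. x i ^ k i) = poly P (x (m + 1))}"

end

theory Submission
  imports Defs "HOL-Number_Theory.Cong"
begin

text \<open>
  Let \<open>D\<close> be a locally nilpotent derivation of the algebra of regular functions on \<open>Y\<close>. For a point \<open>p\<close>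
  of \<open>Y\<close>, the exponential \<open>f \<mapsto> \<Sum>\<^sub>i t\<^sup>i / i! (D\<^sup>i f)(p)\<close> is a homomorphism from this algebra to \<open>K[t]\<close>, that is,
  a polynomial curve \<open>\<gamma>(t) = (y\<^sub>1(t), \<dots>, y\<^sub>m(t), z(t))\<close> in \<open>Y\<close> starting at \<open>p\<close>: the orbit of \<open>p\<close> under the
  action of the additive group generated by \<open>D\<close>. It satisfies \<open>\<gamma>' = V(\<gamma>)\<close>, where \<open>V\<close> is the vector field with
  components \<open>D y\<^sub>i\<close> and \<open>D z\<close>. The claim is that the orbit is a point whenever \<open>P(z(p)) \<noteq> 0\<close>. Then \<open>D f\<close>
  vanishes on the subset \<open>P(z) \<noteq> 0\<close>, which is dense in \<open>Y\<close>, and so \<open>D f = 0\<close>.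
  
  It suffices that \<open>z(t)\<close> is constant, because then the product of the \<open>y\<^sub>i(t) ^ k\<^sub>i\<close> is a nonzero constant, and
  all \<open>y\<^sub>i(t)\<close> are units of \<open>K[t]\<close>. There are two cases.
  
  If all roots of \<open>P\<close> are simple, then every polynomial curve in \<open>Y\<close> has constant
  \<open>z(t)\<close>, by the count of zeros of \<open>z'\<close> in \<open>constant_if_product_of_powers\<close>.
  
  If \<open>P\<close> has a multiple root \<open>a\<close>, polynomial curves with nonconstant \<open>z(t)\<close> may exist (as on \<open>y\<^sup>2 = z\<^sup>2\<close>), but they
  meet the linear subspaces \<open>y\<^sub>i = 0, z = a\<close>, along which \<open>Y\<close> is singular. Such a subspace is
  invariant under the action: \<open>tangent_to_singular_divisor\<close> shows that both \<open>D y\<^sub>i\<close> and \<open>D z\<close> vanish on it.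
  Hence, by uniqueness of solutions of \<open>\<gamma>' = V(\<gamma>)\<close>, an orbit starting outside never enters it
  (\<open>orbit_avoids_multiple_root\<close>). So \<open>z(t) - a\<close> has no zeros, and \<open>z(t)\<close> is constant.
  
  Both the density of \<open>P(z) \<noteq> 0\<close> and the vanishing of \<open>D y\<^sub>i\<close> and \<open>D z\<close> are reduced to plane curves in \<open>Y\<close> of the form
  \<open>Q(s) = P(z)\<close>, whose vanishing ideal is generated by \<open>Q(s) - P(z)\<close> (\<open>dvd_if_vanishes_on_curve\<close>).
\<close>

section \<open>Univariate polynomials and their zeros\<close>

lemma poly_eqI_pderiv:
  fixes p q :: "'k::field_char_0 poly"
  assumes "pderiv p = pderiv q" "poly p t = poly q t"
  shows "p = q"
proof -
  have "degree (p - q) = 0" using assms(1) by (simp add: pderiv_diff flip: pderiv_eq_0_iff)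
  then obtain c where "p - q = [:c:]" by (rule degree_eq_zeroE)
  moreover have "poly (p - q) t = 0" using assms(2) by simp
  ultimately show ?thesis by simp
qed

lemma poly_eq_0_if_cofinite_roots:
  fixes p :: "'k::field_char_0 poly"
  assumes "finite B" "\<And>s. s \<notin> B \<Longrightarrow> poly p s = 0"
  shows "p = 0"
proof (rule ccontr)
  assume "p \<noteq> 0"
  then have "finite (B \<union> {s. poly p s = 0})" using assms(1) poly_roots_finite by blast
  moreover have "B \<union> {s. poly p s = 0} = UNIV" using assms(2) by blast
  ultimately show False by (simp add: infinite_UNIV_char_0)
qed

lemma size_proots_alg_closed:
  fixes p :: "'k::alg_closed_field poly"
  shows "size (proots p) = degree p"
proof (cases "p = 0")
  case False
  from alg_closed_imp_factorization[OF this] obtain A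
    where A: "size A = degree p" "p = smult (lead_coeff p) (\<Prod>x\<in>#A. [:-x, 1:])" by blast
  have "proots (\<Prod>x\<in>#A. [:-x, 1:]) = A"
  proof (induction A)
    case (add x A)
    have "(\<Prod>x\<in>#A. [:-x, 1:]) \<noteq> 0" by (auto simp: prod_mset_zero_iff)
    with add show ?case by (simp add: proots_mult del: mult_pCons_left)
  qed simp
  with A False show ?thesis
    by (metis leading_coeff_0_iff proots_smult)
qed simp

text \<open>
  The hypothesis makes \<open>P - c\<close> squarefree, so its roots are counted without multiplicity.
\<close>
lemma card_fibre_eq_degree:
  fixes P :: "'k::{alg_closed_field, field_char_0} poly"
  assumes "degree P > 0" "\<And>z. poly P z = c \<Longrightarrow> poly (pderiv P) z \<noteq> 0"
  shows "card {z. poly P z = c} = degree P"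
proof -
  let ?p = "P - [:c:]"
  have deg: "degree ?p = degree P"
    using assms(1) by (simp add: degree_diff_less degree_add_eq_left diff_conv_add_uminus del: add_uminus_conv_diff)
  have "?p \<noteq> 0" using deg assms(1) by auto
  have "rsquarefree ?p"
    using assms(2) by (auto simp: rsquarefree_roots pderiv_diff pderiv_pCons)
  then have "count (proots ?p) x = (if x \<in># proots ?p then 1 else 0)" for x
    using rsquarefree_root_order[of ?p x] \<open>?p \<noteq> 0\<close>
    by (auto simp: order_root simp del: poly_diff)
  then have "proots ?p = mset_set (set_mset (proots ?p))"
    by (intro multiset_eqI) (auto simp: count_mset_set')
  then have "size (proots ?p) = card (set_mset (proots ?p))"
    by (metis size_mset_set)
  with \<open>?p \<noteq> 0\<close> show ?thesis
    by (simp add: size_proots_alg_closed deg)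
qed

text \<open>
  In characteristic zero, differentiation lowers the order of a zero by exactly one.
\<close>
lemma linear_power_dvd_if_dvd_pderiv:
  fixes g :: "'k::field_char_0 poly"
  assumes "[:-t, 1:] ^ N dvd pderiv g" "poly g t = 0"
  shows "[:-t, 1:] ^ Suc N dvd g"
proof (cases "g = 0")
  case False
  have "pderiv g \<noteq> 0"
    using False poly_eqI_pderiv[of g 0 t] assms(2) by auto
  then show ?thesis
    using assms(1) order_pderiv[OF False assms(2)] by (simp add: order_divides del: power_Suc)
qed simp

text \<open>
  A root of the product is a root of some \<open>y i\<close>, which occurs at least squared, hence a multiple root of the
  product.
\<close>
lemma pderiv_eq_0_at_root_of_powers:
  fixes y :: "'i \<Rightarrow> 'k::field poly"
  assumes "finite I" "\<And>i. i \<in> I \<Longrightarrow> k i \<ge> 2" and zero: "poly (\<Prod>i\<in>I. y i ^ k i) t = 0"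
  shows "poly (pderiv (\<Prod>i\<in>I. y i ^ k i)) t = 0"
proof -
  from zero assms(1) obtain i where i: "i \<in> I" "poly (y i) t = 0"
    by (auto simp: poly_prod)
  then have "[:-t, 1:] ^ 2 dvd y i ^ k i"
    using assms(2)[OF i(1)] by (metis dvd_power_same power_le_dvd poly_eq_0_iff_dvd)
  also have "y i ^ k i dvd (\<Prod>i\<in>I. y i ^ k i)" using i assms(1) by (intro dvd_prodI)
  finally obtain q where "(\<Prod>i\<in>I. y i ^ k i) = [:-t, 1:] ^ 2 * q" by (rule dvdE)
  then show ?thesis by (simp add: pderiv_mult power2_eq_square pderiv_pCons del: mult_pCons_left mult_pCons_right)
qed

text \<open>
  A special case of the Mason-Stothers inequality. For a root \<open>c\<close> of \<open>P\<close>, every zero of \<open>z - c\<close> is a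
  multiple zero of \<open>P(z)\<close>, and as \<open>c\<close> is a simple root of \<open>P\<close>, it is a zero of \<open>z'\<close>. So each zero of
  \<open>z - c\<close> of order \<open>\<mu>\<close> is one of \<open>z'\<close> of order \<open>\<mu> - 1 \<ge> \<mu> / 2\<close>. With two distinct roots \<open>a\<close>, \<open>b\<close> of
  \<open>P\<close>, the product \<open>(z - a) * (z - b)\<close> divides the square of \<open>z'\<close>, which for nonconstant \<open>z\<close> has
  smaller degree.
\<close>
lemma constant_if_product_of_powers:
  fixes P z :: "'k::{alg_closed_field, field_char_0} poly" and y :: "'i \<Rightarrow> 'k poly"
  assumes I: "finite I" "\<And>i. i \<in> I \<Longrightarrow> k i \<ge> 2"
    and eq: "(\<Prod>i\<in>I. y i ^ k i) = pcompose P z"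
    and P: "degree P \<ge> 2" "\<And>a. poly P a = 0 \<Longrightarrow> poly (pderiv P) a \<noteq> 0"
  shows "degree z = 0"
proof (rule ccontr)
  assume z: "degree z \<noteq> 0"
  have "card {a. poly P a = 0} = degree P"
    using P by (intro card_fibre_eq_degree) auto
  with P(1) obtain T where "T \<subseteq> {a. poly P a = 0}" "card T = 2"
    by (metis obtain_subset_with_card_n)
  then obtain a b where ab: "poly P a = 0" "poly P b = 0" "a \<noteq> b"
    by (auto simp: card_2_iff)
  define w where "w = (z - [:a:]) * (z - [:b:])"
  have nz: "z - [:c:] \<noteq> 0" for c using z by auto
  have deg: "degree (z - [:c:]) = degree z" for c
    using z by (simp add: degree_add_eq_left diff_conv_add_uminus del: add_uminus_conv_diff)
  have z': "pderiv z \<noteq> 0" using z by (simp add: pderiv_eq_0_iff)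
  have ord: "order t (z - [:c:]) \<le> 2 * order t (pderiv z)" if c: "poly P c = 0" for t c
  proof (cases "poly z t = c")
    case True
    have "poly (pderiv (pcompose P z)) t = 0"
      unfolding eq[symmetric]
      by (rule pderiv_eq_0_at_root_of_powers[OF I]) (use c True in \<open>simp_all add: eq poly_pcompose\<close>)
    then have "poly (pderiv z) t = 0"
      using P(2)[OF c] True by (simp add: pderiv_pcompose poly_pcompose)
    then have "order t (pderiv z) \<noteq> 0" using z' order_root by blast
    moreover have "order t (z - [:c:]) = Suc (order t (pderiv z))"
      using order_pderiv[OF nz[of c], of t] True by (simp add: pderiv_diff)
    ultimately show ?thesis by simp
  next
    case False
    then have "order t (z - [:c:]) = 0" by (intro order_0I) simp
    then show ?thesis by simp
  qed
  have "proots w \<subseteq># proots (pderiv z ^ 2)"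
  proof (rule mset_subset_eqI)
    fix t
    have "order t w = order t (z - [:a:]) + order t (z - [:b:])"
      unfolding w_def by (rule order_mult) (use nz in simp)
    moreover have "order t (z - [:a:]) = 0 \<or> order t (z - [:b:]) = 0"
      using ab(3) by (cases "poly z t = a") (auto intro!: order_0I)
    ultimately have "order t w \<le> 2 * order t (pderiv z)"
      using ord[OF ab(1), of t] ord[OF ab(2), of t] by auto
    then show "count (proots w) t \<le> count (proots (pderiv z ^ 2)) t"
      using nz z' by (simp add: w_def proots_power)
  qed
  then have "size (proots w) \<le> size (proots (pderiv z ^ 2))" by (rule size_mset_mono)
  then have "degree w \<le> degree (pderiv z ^ 2)" by (simp only: size_proots_alg_closed)
  also have "degree w = 2 * degree z" using nz by (simp add: w_def degree_mult_eq deg)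
  also have "degree (pderiv z ^ 2) = 2 * (degree z - 1)"
    using z' by (simp add: degree_power_eq degree_pderiv)
  finally show False using z by simp
qed

lemma constant_if_powers_constant:
  fixes y :: "'i \<Rightarrow> 'k::field poly"
  assumes "finite I" "\<And>i. i \<in> I \<Longrightarrow> k i \<ge> 1" "(\<Prod>i\<in>I. y i ^ k i) = [:c:]" "c \<noteq> 0" "i \<in> I"
  shows "degree (y i) = 0"
proof -
  have "y i dvd y i ^ k i" using assms(2)[OF assms(5)] by (intro dvd_power) auto
  also have "\<dots> dvd [:c:]" unfolding assms(3)[symmetric] using assms(1,5) by (intro dvd_prodI)
  finally have "y i dvd [:c:]" .
  then have "degree (y i) \<le> degree [:c:]" using assms(4) by (intro dvd_imp_degree_le) auto
  then show ?thesis by simp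
qed

section \<open>Plane curves with separated variables\<close>

lemma poly_map_poly_eval: "poly (map_poly (\<lambda>c. poly c s) p) z = poly (poly p [:z:]) s"
  by (induction p) (auto simp: map_poly_pCons)

text \<open>
  Elements of \<open>K[s][z]\<close> are represented with \<open>z\<close> as the outer variable. The leading coefficient of
  \<open>Q(s) - P(z)\<close> in \<open>z\<close> is a nonzero constant, so division leaves a remainder of \<open>z\<close>-degree less than
  \<open>degree P\<close>. For all but finitely many \<open>s\<close> the value \<open>Q(s)\<close> is nonzero and is not a critical value of
  \<open>P\<close>; then the equation \<open>P(z) = Q(s)\<close> has \<open>degree P\<close> distinct solutions, which are too many roots for
  a nonzero remainder. In particular the curve is reduced and the points with \<open>Q(s) \<noteq> 0\<close> are dense in it.
\<close>
lemma dvd_if_vanishes_on_curve: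
  fixes P Q :: "'k::{alg_closed_field, field_char_0} poly"
  assumes P: "degree P > 0" and Q: "degree Q > 0"
    and f: "\<And>s z. poly Q s = poly P z \<Longrightarrow> poly Q s \<noteq> 0 \<Longrightarrow> poly (poly f [:z:]) s = 0"
  shows "[:Q:] - map_poly (\<lambda>c. [:c:]) P dvd f"
proof -
  define F where "F = [:Q:] - map_poly (\<lambda>c. [:c:]) P"
  have degl: "degree (map_poly (\<lambda>c. [:c:]) P) = degree P"
    by (rule degree_map_poly) auto
  have coeffF: "coeff F n = (if n = 0 then Q else 0) - [:coeff P n:]" for n
    by (auto simp: F_def coeff_map_poly coeff_pCons split: nat.splits)
  have degF: "degree F = degree P"
  proof (rule antisym)
    show "degree F \<le> degree P"
      by (rule degree_le) (use P in \<open>auto simp: coeffF coeff_eq_0\<close>)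
    show "degree P \<le> degree F"
      by (rule le_degree) (use P in \<open>auto simp: coeffF\<close>)
  qed
  have F0: "F \<noteq> 0" using degF P by auto
  have lcF: "coeff F (degree F) = [:- lead_coeff P:]"
    using P by (simp add: degF coeffF)
  have evF: "poly (poly F [:z:]) s = poly Q s - poly P z" for s z
    by (simp add: F_def flip: pcompose_altdef) (simp add: poly_pcompose)
  obtain q r where qr: "pseudo_divmod f F = (q, r)" by force
  define N where "N = Suc (degree f) - degree P"
  have div: "smult ([:- lead_coeff P:] ^ N) f = F * q + r"
    and degr: "r = 0 \<or> degree r < degree P"
    using pseudo_divmod[OF F0 qr] by (simp_all add: lcF[unfolded degF] N_def degF)
  define B where "B = {s. poly Q s = 0} \<union> (\<Union>z\<in>{z. poly (pderiv P) z = 0}. {s. poly Q s = poly P z})"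
  have fin: "finite {s. poly Q s = c}" for c
  proof -
    have "Q - [:c:] \<noteq> 0" using Q by auto
    from poly_roots_finite[OF this] show ?thesis by simp
  qed
  have "finite B"
    unfolding B_def using P by (intro finite_UnI finite_UN_I fin poly_roots_finite)
      (auto simp: pderiv_eq_0_iff)
  have "r = 0"
  proof (rule ccontr)
    assume "r \<noteq> 0"
    have zero: "poly (coeff r n) s = 0" if s: "s \<notin> B" for s n
    proof -
      define rs where "rs = map_poly (\<lambda>c. poly c s) r"
      have "rs = 0"
      proof (rule ccontr)
        assume "rs \<noteq> 0"
        have "{z. poly P z = poly Q s} \<subseteq> {z. poly rs z = 0}"
        proof safe
          fix z assume z: "poly P z = poly Q s"
          have "poly (poly f [:z:]) s = 0"
            using s z by (intro f) (auto simp: B_def)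
          then have "poly (poly (smult ([:- lead_coeff P:] ^ N) f) [:z:]) s = 0"
            by simp
          then show "poly rs z = 0"
            unfolding div by (simp add: rs_def poly_map_poly_eval evF z)
        qed
        moreover have "card {z. poly P z = poly Q s} = degree P"
          using s P by (intro card_fibre_eq_degree) (auto simp: B_def)
        ultimately have "degree P \<le> card {z. poly rs z = 0}"
          using \<open>rs \<noteq> 0\<close> by (metis card_mono poly_roots_finite)
        also have "\<dots> \<le> degree rs" using \<open>rs \<noteq> 0\<close> by (rule card_poly_roots_bound)
        also have "\<dots> \<le> degree r" unfolding rs_def by (rule map_poly_degree_leq)
        finally show False using degr \<open>r \<noteq> 0\<close> by simp
      qed
      then have "coeff rs n = 0" by simp
      then show ?thesis by (simp add: rs_def coeff_map_poly)
    qed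
    have "coeff r n = 0" for n
      using \<open>finite B\<close> zero by (rule poly_eq_0_if_cofinite_roots)
    with \<open>r \<noteq> 0\<close> show False by (auto simp: poly_eq_iff)
  qed
  then have "F dvd smult ([:- lead_coeff P:] ^ N) f" using div by simp
  then have "F dvd smult ([:- inverse (lead_coeff P):] ^ N) (smult ([:- lead_coeff P:] ^ N) f)"
    by (rule dvd_smult)
  moreover have "[:- inverse (lead_coeff P):] ^ N * [:- lead_coeff P:] ^ N = 1"
  proof -
    have "lead_coeff P * inverse (lead_coeff P) = 1" using P by (intro right_inverse) auto
    then show ?thesis by (simp add: power_mult_distrib[symmetric] one_pCons[symmetric])
  qed
  ultimately show ?thesis by (simp add: F_def)
qed

text \<open>
  The relation says that the vector field \<open>v \<partial>\<^sub>s + u \<partial>\<^sub>z\<close>, up to the correction \<open>w\<close> for the motion of the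
  coefficient \<open>c\<close>, is tangent to the curve \<open>c * s ^ k = P(z)\<close>. As it holds on the curve, it holds
  in \<open>K[s, z]\<close> up to a multiple \<open>(c * s ^ k - P(z)) * h\<close>. At a root \<open>a\<close> of order \<open>e \<ge> 2\<close>, put \<open>z = a\<close>
  and cancel \<open>s ^ (k - 1)\<close> to see that \<open>v(s, a)\<close> is divisible by \<open>s\<close>; put \<open>s = 0\<close>, where the
  first two terms vanish because of \<open>k \<ge> 2\<close>, and cancel \<open>(z - a) ^ (e - 1)\<close> to see that \<open>u(0, z)\<close> is divisible by \<open>z - a\<close>. So both components vanish at
  the point \<open>(0, a)\<close>.
\<close>
lemma tangent_to_axis_at_multiple_root:
  fixes P :: "'k::{alg_closed_field, field_char_0} poly" and u v w :: "'k poly poly"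
  assumes P: "degree P > 0" "poly P a = 0" "poly (pderiv P) a = 0" and c: "c \<noteq> 0" and k: "k \<ge> 2"
    and rel: "\<And>s z. c * s ^ k = poly P z \<Longrightarrow>
      of_nat k * c * s ^ (k - 1) * poly (poly v [:z:]) s + s ^ k * poly (poly w [:z:]) s =
      poly (pderiv P) z * poly (poly u [:z:]) s"
  shows "poly (poly v [:a:]) 0 = 0" "poly (poly u [:a:]) 0 = 0"
proof -
  define f where "f = [:monom (of_nat k * c) (k - 1):] * v + [:monom 1 k:] * w
      - map_poly (\<lambda>c. [:c:]) (pderiv P) * u"
  have lift: "poly (poly (map_poly (\<lambda>c. [:c:]) p) [:z:]) s = poly p z" for p :: "'k poly" and s z
    by (simp add: poly_pcompose flip: pcompose_altdef)
  have ev: "poly (poly f [:z:]) s = of_nat k * c * s ^ (k - 1) * poly (poly v [:z:]) s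
      + s ^ k * poly (poly w [:z:]) s - poly (pderiv P) z * poly (poly u [:z:]) s" for s z
    by (simp add: f_def lift poly_monom)
  have "[:monom c k:] - map_poly (\<lambda>c. [:c:]) P dvd f"
    using P(1) c k rel by (intro dvd_if_vanishes_on_curve) (auto simp: degree_monom_eq poly_monom ev)
  then obtain h where "f = ([:monom c k:] - map_poly (\<lambda>c. [:c:]) P) * h" by (rule dvdE)
  then have eq: "of_nat k * c * s ^ (k - 1) * poly (poly v [:z:]) s
      + s ^ k * poly (poly w [:z:]) s - poly (pderiv P) z * poly (poly u [:z:]) s =
      (c * s ^ k - poly P z) * poly (poly h [:z:]) s" for s z
    unfolding ev[symmetric] by (simp add: lift poly_monom)
  let ?g = "smult (of_nat k * c) (poly v [:a:]) + [:0, 1:] * (poly w [:a:] - smult c (poly h [:a:]))"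
  have "?g = 0"
  proof (rule poly_eq_0_if_cofinite_roots[of "{0}"])
    fix s :: 'k assume s: "s \<notin> {0}"
    have "s ^ k = s ^ (k - 1) * s" using k by (cases k) auto
    then have "s ^ (k - 1) * poly ?g s = 0"
      using eq[of s a] P(2,3) by (simp add: algebra_simps)
    then show "poly ?g s = 0" using s by simp
  qed simp
  then have "poly ?g 0 = 0" by (simp only: poly_0)
  then show "poly (poly v [:a:]) 0 = 0" using c k by simp
  let ?u = "map_poly (\<lambda>c. poly c 0) u" and ?h = "map_poly (\<lambda>c. poly c 0) h"
  have zero_pow: "(0 :: 'k) ^ (k - 1) = 0" "(0 :: 'k) ^ k = 0"
    using k by (simp_all add: power_0_left)
  have "poly (pderiv P * ?u) z = poly (P * ?h) z" for z
    using eq[of 0 z] unfolding zero_pow by (simp add: poly_map_poly_eval)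
  then have prod: "pderiv P * ?u = P * ?h" by (simp add: poly_eq_poly_eq_iff[symmetric] fun_eq_iff)
  show "poly (poly u [:a:]) 0 = 0"
  proof (rule ccontr)
    assume "poly (poly u [:a:]) 0 \<noteq> 0"
    then have ua: "poly ?u a \<noteq> 0" by (simp add: poly_map_poly_eval)
    have nz: "P \<noteq> 0" "pderiv P \<noteq> 0" using P(1) by (auto simp: pderiv_eq_0_iff)
    then have nzu: "pderiv P * ?u \<noteq> 0" using ua by auto
    have "order a P = Suc (order a (pderiv P))" using nz P(2) by (intro order_pderiv)
    moreover have "order a (pderiv P * ?u) = order a (pderiv P)"
      using order_mult[OF nzu, of a] order_0I[OF ua] by simp
    moreover have "order a (P * ?h) \<ge> order a P"
      using order_mult[of P ?h a] nzu prod by simp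
    ultimately show False using prod by simp
  qed
qed

section \<open>Regular functions as polynomial expressions\<close>

text \<open>
  The coefficients and arguments may lie in any ring, so that the expression of a regular function
  can also be evaluated at points with polynomial coordinates, that is, along curves and surfaces.
\<close>
definition eval_terms ::
    "nat \<Rightarrow> (nat \<Rightarrow> nat) set \<Rightarrow> ((nat \<Rightarrow> nat) \<Rightarrow> 'b::comm_semiring_1) \<Rightarrow> (nat \<Rightarrow> 'b) \<Rightarrow> 'b" where
  "eval_terms n S c x = (\<Sum>\<alpha>\<in>S. c \<alpha> * (\<Prod>i=1..n. x i ^ \<alpha> i))"

lemma poly_eval_terms:
  "poly (eval_terms n S c g) t = eval_terms n S (\<lambda>\<alpha>. poly (c \<alpha>) t) (\<lambda>i. poly (g i) t)"
  by (simp add: eval_terms_def poly_sum poly_prod)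

lemma poly2_eval_terms:
  "poly (poly (eval_terms n S (\<lambda>\<alpha>. [:[:c \<alpha>:]:]) g) [:z:]) s =
    eval_terms n S c (\<lambda>i. poly (poly (g i) [:z:]) s)"
  by (simp add: poly_eval_terms)

lemma eval_terms_cong:
  "(\<And>i. i \<in> {1..n} \<Longrightarrow> x i = y i) \<Longrightarrow> eval_terms n S c x = eval_terms n S c y"
  by (simp add: eval_terms_def)

lemma eval_terms_dvd_diff:
  fixes x y :: "nat \<Rightarrow> 'k::field poly"
  assumes "\<And>i. i \<in> {1..n} \<Longrightarrow> h dvd x i - y i"
  shows "h dvd eval_terms n S c x - eval_terms n S c y"
proof -
  have "[eval_terms n S c x = eval_terms n S c y] (mod h)"
    unfolding eval_terms_def using assms
    by (intro cong_sum cong_mult cong_prod cong_pow cong_refl) (simp add: cong_iff_dvd_diff)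
  then show ?thesis by (simp add: cong_iff_dvd_diff)
qed

text \<open>
  Restrict to a line through \<open>q\<close> along which each coordinate in \<open>J\<close> vanishes only once: the
  expression becomes a polynomial in one variable with all but finitely many elements of the field as roots.
\<close>
lemma eval_terms_eq_0_if_generic:
  fixes c :: "(nat \<Rightarrow> nat) \<Rightarrow> 'k::field_char_0"
  assumes "finite J"
    and generic: "\<And>x. (\<And>j. j \<notin> J \<Longrightarrow> x j = q j) \<Longrightarrow> (\<And>j. j \<in> J \<Longrightarrow> x j \<noteq> 0) \<Longrightarrow> eval_terms n S c x = 0"
  shows "eval_terms n S c q = 0"
proof -
  define g where "g = (\<lambda>j. if j \<in> J then [:q j, 1:] else [:q j:])"
  define p where "p = eval_terms n S (\<lambda>\<alpha>. [:c \<alpha>:]) g"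
  have ev: "poly p s = eval_terms n S c (\<lambda>j. poly (g j) s)" for s
    by (simp add: p_def poly_eval_terms)
  have "p = 0"
  proof (rule poly_eq_0_if_cofinite_roots)
    show "finite ((\<lambda>j. - q j) ` J)" using assms(1) by simp
    show "poly p s = 0" if "s \<notin> (\<lambda>j. - q j) ` J" for s
      unfolding ev using that
      by (intro generic) (auto simp: g_def add_eq_0_iff image_iff)
  qed
  moreover have "eval_terms n S c q = poly p 0"
    unfolding ev by (rule eval_terms_cong) (simp add: g_def)
  ultimately show ?thesis by simp
qed

lemma regular_functions_eval_termsE:
  assumes "f \<in> regular_functions n Y"
  obtains S c where "finite S" "f = (\<lambda>x\<in>Y. eval_terms n S c x)"
  using assms unfolding regular_functions_def eval_terms_def by blast

lemma regular_functions_restrict: "f \<in> regular_functions n Y \<Longrightarrow> (\<lambda>x\<in>Y. f x) = f"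
  by (intro extensional_restrict regular_functions_extensional)

lemma regular_functions_power:
  assumes "f \<in> regular_functions n Y"
  shows "(\<lambda>x\<in>Y. f x ^ k) \<in> regular_functions n Y"
proof (induction k)
  case (Suc k)
  from regular_functions_mult[OF assms Suc] show ?case by (simp add: restrict_def cong: if_cong)
qed (simp add: regular_functions_const[unfolded restrict_def] restrict_def)

lemma regular_functions_prod:
  assumes "\<And>i. i \<in> I \<Longrightarrow> f i \<in> regular_functions n Y"
  shows "(\<lambda>x\<in>Y. \<Prod>i\<in>I. f i x) \<in> regular_functions n Y"
  using assms
proof (induction I rule: infinite_finite_induct)
  case (insert i I)
  from insert regular_functions_mult[of "f i" n Y "\<lambda>x\<in>Y. \<Prod>i\<in>I. f i x"] show ?case
    by (simp add: restrict_def cong: if_cong)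
qed (simp_all add: regular_functions_const[unfolded restrict_def] restrict_def)

lemma regular_functions_sum:
  assumes "\<And>i. i \<in> I \<Longrightarrow> f i \<in> regular_functions n Y"
  shows "(\<lambda>x\<in>Y. \<Sum>i\<in>I. f i x) \<in> regular_functions n Y"
  using assms
proof (induction I rule: infinite_finite_induct)
  case (insert i I)
  from insert regular_functions_add[of "f i" n Y "\<lambda>x\<in>Y. \<Sum>i\<in>I. f i x"] show ?case
    by (simp add: restrict_def cong: if_cong)
qed (simp_all add: regular_functions_const[unfolded restrict_def] restrict_def)

lemma regular_functions_poly:
  assumes "f \<in> regular_functions n Y"
  shows "(\<lambda>x\<in>Y. poly P (f x)) \<in> regular_functions n Y"
proof (induction P)
  case (pCons a P)
  from regular_functions_add[OF regular_functions_const[where c = a]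
      regular_functions_mult[OF assms pCons(2)]]
  show ?case by (simp add: restrict_def cong: if_cong)
qed (simp add: regular_functions_const[unfolded restrict_def] restrict_def)

section \<open>Orbits of a locally nilpotent derivation\<close>

locale locally_nilpotent_derivation =
  fixes n :: nat and Y :: "(nat \<Rightarrow> 'k::field_char_0) set" and D
  assumes derivation: "derivation (regular_algebra n Y) D"
    and locally_nilpotent: "locally_nilpotent (regular_algebra n Y) D"
begin

abbreviation R where "R \<equiv> regular_functions n Y"

lemma D_closed: "f \<in> R \<Longrightarrow> D f \<in> R"
  using derivation by (auto simp: derivation_def regular_algebra_def)

lemma D_add: "f \<in> R \<Longrightarrow> g \<in> R \<Longrightarrow> D (\<lambda>x\<in>Y. f x + g x) = (\<lambda>x\<in>Y. D f x + D g x)"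
  using derivation by (auto simp: derivation_def regular_algebra_def)

lemma D_smult: "f \<in> R \<Longrightarrow> D (\<lambda>x\<in>Y. c * f x) = (\<lambda>x\<in>Y. c * D f x)"
  using derivation by (auto simp: derivation_def regular_algebra_def)

lemma D_mult:
  "f \<in> R \<Longrightarrow> g \<in> R \<Longrightarrow> D (\<lambda>x\<in>Y. f x * g x) = (\<lambda>x\<in>Y. D f x * g x + f x * D g x)"
  using derivation by (auto simp: derivation_def regular_algebra_def restrict_def cong: if_cong)

lemma D_const: "D (\<lambda>x\<in>Y. c) = (\<lambda>x\<in>Y. 0)"
proof -
  let ?one = "\<lambda>x\<in>Y. 1 :: 'k"
  have one: "?one \<in> R" by (rule regular_functions_const)
  have "D ?one x = 0" if "x \<in> Y" for x
    using fun_cong[OF D_mult[OF one one], of x] that by (simp add: restrict_def cong: if_cong)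
  with D_smult[OF one, of c] show ?thesis by (simp add: restrict_def cong: if_cong)
qed

lemma funpow_closed: "f \<in> R \<Longrightarrow> (D ^^ i) f \<in> R"
  by (induction i) (auto intro: D_closed)

lemma funpow_zero: "(D ^^ i) (\<lambda>x\<in>Y. 0) = (\<lambda>x\<in>Y. 0)"
  by (induction i) (simp_all only: funpow.simps id_apply o_apply D_const)

lemma nilpotent:
  assumes "f \<in> R"
  obtains N where "(D ^^ N) f = (\<lambda>x\<in>Y. 0)"
  using locally_nilpotent assms by (auto simp: locally_nilpotent_def regular_algebra_def)

text \<open>
  The evaluation at \<open>p\<close> of the exponential \<open>exp (t D) f\<close>, a polynomial in \<open>t\<close> as \<open>D\<close> is locally nilpotent.
\<close>
definition orbit :: "(nat \<Rightarrow> 'k) \<Rightarrow> ((nat \<Rightarrow> 'k) \<Rightarrow> 'k) \<Rightarrow> 'k poly" where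
  "orbit p f = Abs_poly (\<lambda>i. (D ^^ i) f p / fact i)"

lemma coeff_orbit:
  assumes "p \<in> Y" "f \<in> R"
  shows "coeff (orbit p f) i = (D ^^ i) f p / fact i"
proof -
  obtain N where N: "(D ^^ N) f = (\<lambda>x\<in>Y. 0)" using assms(2) by (rule nilpotent)
  have "(D ^^ i) f p = 0" if "i > N" for i
  proof -
    have "(D ^^ i) f = (D ^^ (i - N)) ((D ^^ N) f)"
      using that by (metis comp_apply funpow_add le_add_diff_inverse2 less_imp_le)
    then show ?thesis using assms(1) by (simp add: N funpow_zero)
  qed
  then show ?thesis unfolding orbit_def by (subst coeff_Abs_poly) auto
qed

lemma poly_orbit_0: "p \<in> Y \<Longrightarrow> f \<in> R \<Longrightarrow> poly (orbit p f) 0 = f p"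
  by (simp add: poly_0_coeff_0 coeff_orbit)

lemma pderiv_orbit:
  assumes "p \<in> Y" "f \<in> R"
  shows "pderiv (orbit p f) = orbit p (D f)"
proof (rule poly_eqI)
  fix i
  have "of_nat (Suc i) * ((D ^^ Suc i) f p / fact (Suc i)) = (D ^^ i) (D f) p / fact i"
    by (simp only: fact_Suc funpow_Suc_right o_apply) (simp add: field_simps del: of_nat_Suc)
  then show "coeff (pderiv (orbit p f)) i = coeff (orbit p (D f)) i"
    using assms by (simp add: coeff_pderiv coeff_orbit D_closed del: funpow.simps)
qed

lemma orbit_const: "p \<in> Y \<Longrightarrow> orbit p (\<lambda>x\<in>Y. c) = [:c:]"
proof (rule poly_eqI)
  fix i assume p: "p \<in> Y"
  show "coeff (orbit p (\<lambda>x\<in>Y. c)) i = coeff [:c:] i"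
    unfolding coeff_orbit[OF p regular_functions_const]
    using p by (cases i) (simp_all only: funpow_Suc_right o_apply D_const funpow_zero, simp_all)
qed

lemma orbit_add:
  assumes p: "p \<in> Y" and "f \<in> R" "g \<in> R"
  shows "orbit p (\<lambda>x\<in>Y. f x + g x) = orbit p f + orbit p g"
proof -
  have "(D ^^ i) (\<lambda>x\<in>Y. f x + g x) = (\<lambda>x\<in>Y. (D ^^ i) f x + (D ^^ i) g x)" for i
    by (induction i) (simp_all only: funpow.simps id_apply o_apply D_add funpow_closed assms)
  with assms show ?thesis
    by (intro poly_eqI) (simp add: coeff_orbit regular_functions_add add_divide_distrib)
qed

text \<open>
  Both sides have the same value at \<open>t = 0\<close>, and by the product rule their derivatives agree if the claim
  holds for the pairs \<open>(D f, g)\<close> and \<open>(f, D g)\<close>. So induction on the sum of the nilpotency orders of \<open>f\<close> and \<open>g\<close>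
  takes the place of the binomial formula for the iterates of \<open>D\<close>.
\<close>
lemma orbit_mult:
  assumes p: "p \<in> Y" and "f \<in> R" "g \<in> R"
  shows "orbit p (\<lambda>x\<in>Y. f x * g x) = orbit p f * orbit p g"
proof -
  have zero: "orbit p (\<lambda>x\<in>Y. 0) = 0" using orbit_const[OF p, of 0] by simp
  have "orbit p (\<lambda>x\<in>Y. f x * g x) = orbit p f * orbit p g"
    if "(D ^^ M) f = (\<lambda>x\<in>Y. 0)" "(D ^^ N) g = (\<lambda>x\<in>Y. 0)" "f \<in> R" "g \<in> R" for M N f g
    using that
  proof (induction "M + N" arbitrary: M N f g rule: less_induct)
    case less
    show ?case
    proof (cases "M = 0 \<or> N = 0")
      case True
      then have fg: "f = (\<lambda>x\<in>Y. 0) \<or> g = (\<lambda>x\<in>Y. 0)"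
        using less.prems(1,2) by (elim disjE) (simp_all only: funpow_0 simp_thms)
      then have "(\<lambda>x\<in>Y. f x * g x) = (\<lambda>x\<in>Y. 0)" by (auto simp: restrict_def)
      moreover have "orbit p f * orbit p g = 0"
        using fg by (elim disjE) (simp_all only: zero mult_zero_left mult_zero_right)
      ultimately show ?thesis using zero by (simp only:)
    next
      case False
      then obtain M' N' where MN: "M = Suc M'" "N = Suc N'" by (metis not0_implies_Suc)
      note R = less.prems(3,4) D_closed[OF less.prems(3)] D_closed[OF less.prems(4)]
      have f': "(D ^^ M') (D f) = (\<lambda>x\<in>Y. 0)" and g': "(D ^^ N') (D g) = (\<lambda>x\<in>Y. 0)"
        using less.prems(1,2) unfolding MN by (simp_all only: funpow_Suc_right o_apply)
      have IH1: "orbit p (\<lambda>x\<in>Y. D f x * g x) = orbit p (D f) * orbit p g"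
        by (rule less.hyps[OF _ f' less.prems(2) R(3,2)]) (simp add: MN)
      have IH2: "orbit p (\<lambda>x\<in>Y. f x * D g x) = orbit p f * orbit p (D g)"
        by (rule less.hyps[OF _ less.prems(1) g' R(1,4)]) (simp add: MN)
      have split: "(\<lambda>x\<in>Y. D f x * g x + f x * D g x) =
          (\<lambda>x\<in>Y. (\<lambda>x\<in>Y. D f x * g x) x + (\<lambda>x\<in>Y. f x * D g x) x)"
        by (auto simp: restrict_def)
      have "orbit p (\<lambda>x\<in>Y. D f x * g x + f x * D g x) =
          orbit p (D f) * orbit p g + orbit p f * orbit p (D g)"
        unfolding split using R p by (simp only: orbit_add regular_functions_mult IH1 IH2)
      then have "pderiv (orbit p (\<lambda>x\<in>Y. f x * g x)) = pderiv (orbit p f * orbit p g)"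
        using R p
        by (simp only: pderiv_orbit regular_functions_mult D_mult pderiv_mult mult.commute add.commute)
      then show ?thesis
        by (rule poly_eqI_pderiv[where t = 0])
          (use R p in \<open>simp only: poly_orbit_0 regular_functions_mult poly_mult restrict_apply'\<close>)
    qed
  qed
  moreover obtain M N where "(D ^^ M) f = (\<lambda>x\<in>Y. 0)" "(D ^^ N) g = (\<lambda>x\<in>Y. 0)"
    using nilpotent assms(2,3) by meson
  ultimately show ?thesis using assms(2,3) by blast
qed

lemma orbit_power:
  assumes p: "p \<in> Y" and f: "f \<in> R"
  shows "orbit p (\<lambda>x\<in>Y. f x ^ k) = orbit p f ^ k"
proof (induction k)
  case (Suc k)
  from orbit_mult[OF p f regular_functions_power[OF f, of k]] Suc show ?case
    by (simp add: restrict_def cong: if_cong)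
qed (use orbit_const[OF p, of 1] in \<open>simp_all add: restrict_def\<close>)

lemma orbit_prod:
  assumes p: "p \<in> Y" and f: "\<And>i. i \<in> I \<Longrightarrow> f i \<in> R"
  shows "orbit p (\<lambda>x\<in>Y. \<Prod>i\<in>I. f i x) = (\<Prod>i\<in>I. orbit p (f i))"
  using f
proof (induction I rule: infinite_finite_induct)
  case (insert i I)
  have "orbit p (\<lambda>x\<in>Y. f i x * (\<lambda>x\<in>Y. \<Prod>i\<in>I. f i x) x) =
      orbit p (f i) * orbit p (\<lambda>x\<in>Y. \<Prod>i\<in>I. f i x)"
    using insert.prems by (intro orbit_mult[OF p] regular_functions_prod) auto
  with insert show ?case by (simp add: restrict_def cong: if_cong)
qed (use orbit_const[OF p, of 1] in \<open>simp_all add: restrict_def\<close>)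

lemma orbit_sum:
  assumes p: "p \<in> Y" and f: "\<And>i. i \<in> I \<Longrightarrow> f i \<in> R"
  shows "orbit p (\<lambda>x\<in>Y. \<Sum>i\<in>I. f i x) = (\<Sum>i\<in>I. orbit p (f i))"
  using f
proof (induction I rule: infinite_finite_induct)
  case (insert i I)
  have "orbit p (\<lambda>x\<in>Y. f i x + (\<lambda>x\<in>Y. \<Sum>i\<in>I. f i x) x) =
      orbit p (f i) + orbit p (\<lambda>x\<in>Y. \<Sum>i\<in>I. f i x)"
    using insert.prems by (intro orbit_add[OF p] regular_functions_sum) auto
  with insert show ?case by (simp add: restrict_def cong: if_cong)
qed (use orbit_const[OF p, of 0] in \<open>simp_all add: restrict_def\<close>)

lemma orbit_poly:
  assumes p: "p \<in> Y" and f: "f \<in> R"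
  shows "orbit p (\<lambda>x\<in>Y. poly P (f x)) = pcompose P (orbit p f)"
proof (induction P)
  case (pCons a P)
  have "orbit p (\<lambda>x\<in>Y. (\<lambda>x\<in>Y. a) x + (\<lambda>x\<in>Y. f x * (\<lambda>x\<in>Y. poly P (f x)) x) x) =
      [:a:] + orbit p f * pcompose P (orbit p f)"
    unfolding pCons(2)[symmetric] using p f
    by (simp only: orbit_add orbit_mult orbit_const regular_functions_const regular_functions_mult
        regular_functions_poly)
  then show ?case by (simp add: pcompose_pCons restrict_def cong: if_cong)
qed (use orbit_const[OF p, of 0] in \<open>simp_all add: restrict_def\<close>)

abbreviation coord :: "nat \<Rightarrow> (nat \<Rightarrow> 'k) \<Rightarrow> 'k" where "coord j \<equiv> \<lambda>x\<in>Y. x j"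

lemma orbit_eval_terms:
  assumes p: "p \<in> Y"
  shows "orbit p (\<lambda>x\<in>Y. eval_terms n S c x) =
    eval_terms n S (\<lambda>\<alpha>. [:c \<alpha>:]) (\<lambda>j. orbit p (coord j))"
proof -
  let ?pow = "\<lambda>\<alpha> i. \<lambda>x\<in>Y. coord i x ^ \<alpha> i"
  let ?term = "\<lambda>\<alpha>. \<lambda>x\<in>Y. (\<lambda>x\<in>Y. c \<alpha>) x * (\<lambda>x\<in>Y. \<Prod>i=1..n. ?pow \<alpha> i x) x"
  have pow: "?pow \<alpha> i \<in> R" if "i \<in> {1..n}" for \<alpha> i
    by (intro regular_functions_power regular_functions_coord that)
  have prod: "(\<lambda>x\<in>Y. \<Prod>i=1..n. ?pow \<alpha> i x) \<in> R" for \<alpha>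
    by (rule regular_functions_prod) (rule pow)
  have "orbit p (?term \<alpha>) = [:c \<alpha>:] * (\<Prod>i=1..n. orbit p (coord i) ^ \<alpha> i)" for \<alpha>
  proof -
    have "orbit p (?term \<alpha>) = [:c \<alpha>:] * (\<Prod>i=1..n. orbit p (?pow \<alpha> i))"
      unfolding orbit_mult[OF p regular_functions_const prod] orbit_const[OF p]
      by (rule arg_cong[OF orbit_prod[OF p pow]])
    also have "(\<Prod>i=1..n. orbit p (?pow \<alpha> i)) = (\<Prod>i=1..n. orbit p (coord i) ^ \<alpha> i)"
      by (intro prod.cong orbit_power[OF p] regular_functions_coord refl)
    finally show ?thesis .
  qed
  moreover have "orbit p (\<lambda>x\<in>Y. \<Sum>\<alpha>\<in>S. ?term \<alpha> x) = (\<Sum>\<alpha>\<in>S. orbit p (?term \<alpha>))"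
    by (intro orbit_sum[OF p] regular_functions_mult regular_functions_const prod)
  moreover have "(\<lambda>x\<in>Y. \<Sum>\<alpha>\<in>S. ?term \<alpha> x) = (\<lambda>x\<in>Y. eval_terms n S c x)"
    by (auto simp: restrict_def eval_terms_def)
  ultimately show ?thesis by (simp add: eval_terms_def)
qed

text \<open>
  The point of affine space that the curve with coordinate functions \<open>orbit p (coord j)\<close> reaches at time \<open>t\<close>.
  It lies in \<open>Y\<close> if \<open>Y\<close> is Zariski closed.
\<close>
definition flow :: "(nat \<Rightarrow> 'k) \<Rightarrow> 'k \<Rightarrow> nat \<Rightarrow> 'k" where
  "flow p t = (\<lambda>j\<in>{1..n}. poly (orbit p (coord j)) t)"

lemma poly_orbit:
  assumes "p \<in> Y" "f \<in> R" "flow p t \<in> Y"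
  shows "poly (orbit p f) t = f (flow p t)"
proof -
  obtain S c where "f = (\<lambda>x\<in>Y. eval_terms n S c x)"
    using assms(2) by (rule regular_functions_eval_termsE)
  with assms show ?thesis
    by (simp add: orbit_eval_terms poly_eval_terms) (auto intro!: eval_terms_cong simp: flow_def)
qed

end

section \<open>The variety of power products\<close>

lemma power_product_variety_iff:
  "x \<in> power_product_variety m k P \<longleftrightarrow>
    x \<in> affine_space (m + 1) \<and> (\<Prod>i=1..m. x i ^ k i) = poly P (x (m + 1))"
  by (simp add: power_product_variety_def)

text \<open>
  The open subset \<open>P(z) \<noteq> 0\<close> is dense in the variety. Through a point \<open>q\<close> passes the plane curve
  obtained by moving all \<open>y\<^sub>i\<close> as \<open>q\<^sub>i + s\<close>: it is given by \<open>Q(s) = P(z)\<close> with a nonconstant \<open>Q\<close>, and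
  the divisibility lemma for such curves shows that its points with \<open>Q(s) \<noteq> 0\<close> are dense in it.
\<close>
lemma regular_function_eq_0_if_vanishes_generically:
  fixes P :: "'k::{alg_closed_field, field_char_0} poly"
  assumes m: "m \<ge> 1" and P: "degree P > 0" and k: "\<And>i. i \<in> {1..m} \<Longrightarrow> k i \<ge> 1"
    and f: "f \<in> regular_functions (m + 1) (power_product_variety m k P)"
    and vanish: "\<And>x. x \<in> power_product_variety m k P \<Longrightarrow> poly P (x (m + 1)) \<noteq> 0 \<Longrightarrow> f x = 0"
    and q: "q \<in> power_product_variety m k P"
  shows "f q = 0"
proof -
  let ?Y = "power_product_variety m k P"
  obtain S c where f_eq: "f = (\<lambda>x\<in>?Y. eval_terms (m + 1) S c x)"
    using f by (rule regular_functions_eval_termsE)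
  define g where "g = (\<lambda>i. if i = m + 1 then [:0, 1:] else [:[:q i, 1:]:])"
  define B where "B = eval_terms (m + 1) S (\<lambda>\<alpha>. [:[:c \<alpha>:]:]) g"
  define Q where "Q = (\<Prod>i=1..m. [:q i, 1:] ^ k i)"
  define x where "x = (\<lambda>s z. \<lambda>i\<in>{1..m+1}. if i = m + 1 then z else q i + s)"
  have Q: "poly Q s = (\<Prod>i=1..m. x s z i ^ k i)" for s z
    unfolding Q_def poly_prod by (intro prod.cong) (auto simp: x_def)
  have B: "poly (poly B [:z:]) s = eval_terms (m + 1) S c (x s z)" for s z
    unfolding B_def poly2_eval_terms by (intro eval_terms_cong) (auto simp: g_def x_def)
  have "[:q 1, 1:] dvd [:q 1, 1:] ^ k 1" using k[of 1] m by (intro dvd_power) auto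
  also have "[:q 1, 1:] ^ k 1 dvd Q" unfolding Q_def using m by (intro dvd_prodI) auto
  finally have "[:q 1, 1:] dvd Q" .
  moreover have "Q \<noteq> 0" by (auto simp: Q_def)
  ultimately have "degree [:q 1, 1:] \<le> degree Q" by (intro dvd_imp_degree_le)
  then have degQ: "degree Q > 0" by simp
  have "[:Q:] - map_poly (\<lambda>c. [:c:]) P dvd B"
  proof (rule dvd_if_vanishes_on_curve[OF P degQ])
    fix s z assume sz: "poly Q s = poly P z" "poly Q s \<noteq> 0"
    then have xY: "x s z \<in> ?Y"
      by (auto simp: power_product_variety_iff affine_space_def Q[of s z]) (auto simp: x_def)
    from vanish[OF this] sz have "f (x s z) = 0" by (simp add: x_def)
    then show "poly (poly B [:z:]) s = 0" unfolding B f_eq using xY by simp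
  qed
  then obtain h where h: "B = ([:Q:] - map_poly (\<lambda>c. [:c:]) P) * h" by (rule dvdE)
  have q_eq: "x 0 (q (m + 1)) = q"
    using q by (auto simp: x_def power_product_variety_iff affine_space_def PiE_def extensional_def)
  have "poly Q 0 = poly P (q (m + 1))"
    unfolding Q[of 0 "q (m + 1)"] q_eq using q by (simp add: power_product_variety_iff)
  then have "poly (poly B [:q (m + 1):]) 0 = 0"
    unfolding h by (simp add: poly_pcompose flip: pcompose_altdef)
  then show ?thesis using q unfolding B q_eq f_eq by simp
qed

locale derivation_of_power_product_variety =
  locally_nilpotent_derivation "m + 1" "power_product_variety m k P" D
  for m :: nat and k :: "nat \<Rightarrow> nat" and P :: "'k::{alg_closed_field, field_char_0} poly" and D +
  assumes m: "m \<ge> 1" and degP: "degree P \<ge> 2" and k: "\<And>i. i \<in> {1..m} \<Longrightarrow> k i \<ge> 2"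
begin

abbreviation "Y \<equiv> power_product_variety m k P"

lemma k_pos: "i \<in> {1..m} \<Longrightarrow> k i \<ge> 1"
  using k[of i] by simp

lemma coord_closed: "i \<in> {1..m + 1} \<Longrightarrow> coord i \<in> R"
  by (rule regular_functions_coord)

lemma orbit_equation:
  assumes p: "p \<in> Y"
  shows "(\<Prod>i=1..m. orbit p (coord i) ^ k i) = pcompose P (orbit p (coord (m + 1)))"
proof -
  have "(\<Prod>i=1..m. orbit p (coord i) ^ k i) = (\<Prod>i=1..m. orbit p (\<lambda>x\<in>Y. coord i x ^ k i))"
    by (rule prod.cong[OF refl], rule orbit_power[OF p, symmetric], rule coord_closed) simp
  also have "\<dots> = orbit p (\<lambda>x\<in>Y. \<Prod>i=1..m. (\<lambda>x\<in>Y. coord i x ^ k i) x)"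
    by (rule orbit_prod[OF p, symmetric], rule regular_functions_power, rule coord_closed) simp
  also have "\<dots> = orbit p (\<lambda>x\<in>Y. poly P (coord (m + 1) x))"
    by (rule arg_cong[where f = "orbit p"], rule restrict_ext) (simp add: power_product_variety_iff)
  also have "\<dots> = pcompose P (orbit p (coord (m + 1)))"
    by (rule orbit_poly[OF p], rule coord_closed) simp
  finally show ?thesis .
qed

lemma flow_in_variety:
  assumes p: "p \<in> Y"
  shows "flow p t \<in> Y"
proof -
  have "(\<Prod>i=1..m. flow p t i ^ k i) = poly (\<Prod>i=1..m. orbit p (coord i) ^ k i) t"
    unfolding poly_prod flow_def by (intro prod.cong) auto
  also have "\<dots> = poly P (flow p t (m + 1))"
    unfolding orbit_equation[OF p] flow_def by (simp add: poly_pcompose)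
  finally have "(\<Prod>i=1..m. flow p t i ^ k i) = poly P (flow p t (m + 1))" .
  moreover have "flow p t \<in> affine_space (m + 1)"
    unfolding flow_def affine_space_def by auto
  ultimately show ?thesis unfolding power_product_variety_iff by blast
qed

text \<open>
  Apply \<open>D\<close> to \<open>u * x\<^sub>i ^ k\<^sub>i = P(z)\<close>. With the other coordinates collected in \<open>u\<close>, their derivatives
  enter only through \<open>D u\<close>. The product and chain rules are those of \<open>K[t]\<close>, applied to the orbit of \<open>x\<close>
  at \<open>t = 0\<close>.
\<close>
lemma derived_equation:
  assumes i: "i \<in> {1..m}"
  defines "u \<equiv> \<lambda>x\<in>Y. \<Prod>j\<in>{1..m}-{i}. x j ^ k j"
  assumes x: "x \<in> Y"
  shows "u \<in> R" and "of_nat (k i) * u x * x i ^ (k i - 1) * D (coord i) x + x i ^ k i * D u x =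
    poly (pderiv P) (x (m + 1)) * D (coord (m + 1)) x"
proof -
  have "(\<lambda>x\<in>Y. \<Prod>j\<in>{1..m}-{i}. (\<lambda>x\<in>Y. coord j x ^ k j) x) \<in> R"
    by (intro regular_functions_prod regular_functions_power coord_closed) auto
  also have "(\<lambda>x\<in>Y. \<Prod>j\<in>{1..m}-{i}. (\<lambda>x\<in>Y. coord j x ^ k j) x) = u"
    unfolding u_def by (intro restrict_ext) simp
  finally show u: "u \<in> R" .
  have c: "coord i \<in> R" "coord (m + 1) \<in> R"
    by (rule coord_closed, use i in simp)+
  note pow = regular_functions_power[OF c(1), of "k i"]
  have "(\<lambda>x\<in>Y. u x * (\<lambda>x\<in>Y. coord i x ^ k i) x) = (\<lambda>x\<in>Y. poly P (coord (m + 1) x))"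
  proof (rule restrict_ext)
    fix x assume "x \<in> Y"
    moreover have "(\<Prod>j=1..m. x j ^ k j) = x i ^ k i * (\<Prod>j\<in>{1..m}-{i}. x j ^ k j)"
      by (rule prod.remove) (use i in auto)
    ultimately show "u x * (\<lambda>x\<in>Y. coord i x ^ k i) x = poly P (coord (m + 1) x)"
      by (simp add: u_def power_product_variety_iff mult.commute)
  qed
  then have "orbit x (\<lambda>x\<in>Y. u x * (\<lambda>x\<in>Y. coord i x ^ k i) x) =
      orbit x (\<lambda>x\<in>Y. poly P (coord (m + 1) x))"
    by (rule arg_cong)
  then have "orbit x u * orbit x (coord i) ^ k i = pcompose P (orbit x (coord (m + 1)))"
    unfolding orbit_mult[OF x u pow] orbit_power[OF x c(1)] orbit_poly[OF x c(2)] .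
  then have "pderiv (orbit x u * orbit x (coord i) ^ k i) =
      pderiv (pcompose P (orbit x (coord (m + 1))))" by (rule arg_cong)
  then have "orbit x u * smult (of_nat (k i)) (orbit x (coord i) ^ (k i - 1) * orbit x (D (coord i)))
      + orbit x (coord i) ^ k i * orbit x (D u) =
      pcompose (pderiv P) (orbit x (coord (m + 1))) * orbit x (D (coord (m + 1)))"
    by (simp only: pderiv_mult pderiv_power pderiv_pcompose pderiv_orbit[OF x] u c)
  then have "poly (orbit x u * smult (of_nat (k i)) (orbit x (coord i) ^ (k i - 1) * orbit x (D (coord i)))
      + orbit x (coord i) ^ k i * orbit x (D u)) 0 =
      poly (pcompose (pderiv P) (orbit x (coord (m + 1))) * orbit x (D (coord (m + 1)))) 0"
    by (rule arg_cong)
  then have "u x * (of_nat (k i) * (coord i x ^ (k i - 1) * D (coord i) x)) + coord i x ^ k i * D u x =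
      poly (pderiv P) (coord (m + 1) x) * D (coord (m + 1)) x"
    by (simp only: poly_mult poly_add poly_smult poly_power poly_pcompose poly_orbit_0[OF x] u c D_closed)
  then show "of_nat (k i) * u x * x i ^ (k i - 1) * D (coord i) x + x i ^ k i * D u x =
    poly (pderiv P) (x (m + 1)) * D (coord (m + 1)) x"
    using x by (simp add: mult_ac)
qed

text \<open>
  If the other coordinates of \<open>q\<close> are nonzero, fix them and let only \<open>x\<^sub>i = s\<close> and \<open>z\<close> vary: this gives the plane curve
  \<open>b * s ^ k\<^sub>i = P(z)\<close> in \<open>Y\<close>, on which the differentiated equation holds. The components at its point \<open>(0, a)\<close> vanish by
  \<open>tangent_to_axis_at_multiple_root\<close>. Such points \<open>q\<close> are dense in the subspace \<open>x\<^sub>i = 0, z = a\<close>.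
\<close>
lemma tangent_to_singular_divisor:
  assumes i: "i \<in> {1..m}" and a: "poly P a = 0" "poly (pderiv P) a = 0"
    and q: "q \<in> affine_space (m + 1)" "q i = 0" "q (m + 1) = a"
  shows "D (coord i) q = 0" "D (coord (m + 1)) q = 0"
proof -
  define u where "u = (\<lambda>x\<in>Y. \<Prod>j\<in>{1..m}-{i}. x j ^ k j)"
  have in_Y: "x \<in> Y" if "x \<in> affine_space (m + 1)" "x i = 0" "x (m + 1) = a" for x
  proof -
    have "(\<Prod>j=1..m. x j ^ k j) = 0" using i that(2) k[OF i] by (intro prod_zero) auto
    then show ?thesis using that a by (simp add: power_product_variety_iff)
  qed
  have qY: "q \<in> Y" using in_Y[OF q] .
  have u: "u \<in> R" unfolding u_def by (rule derived_equation(1)[OF i qY])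
  have c: "coord i \<in> R" "coord (m + 1) \<in> R"
    by (rule coord_closed, use i in simp)+
  obtain S1 c1 where v: "D (coord i) = (\<lambda>x\<in>Y. eval_terms (m + 1) S1 c1 x)"
    using D_closed[OF c(1)] by (rule regular_functions_eval_termsE)
  obtain S2 c2 where w: "D (coord (m + 1)) = (\<lambda>x\<in>Y. eval_terms (m + 1) S2 c2 x)"
    using D_closed[OF c(2)] by (rule regular_functions_eval_termsE)
  obtain S3 c3 where u': "D u = (\<lambda>x\<in>Y. eval_terms (m + 1) S3 c3 x)"
    using D_closed[OF u] by (rule regular_functions_eval_termsE)
  have generic: "eval_terms (m + 1) S1 c1 r = 0 \<and> eval_terms (m + 1) S2 c2 r = 0"
    if fix_r: "\<And>j. j \<notin> {1..m} - {i} \<Longrightarrow> r j = q j" and nz: "\<And>j. j \<in> {1..m} - {i} \<Longrightarrow> r j \<noteq> 0" for r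
  proof -
    define b where "b = (\<Prod>j\<in>{1..m}-{i}. r j ^ k j)"
    have "b \<noteq> 0" using nz by (simp add: b_def)
    define x where "x = (\<lambda>s z. r(i := s, m + 1 := z))"
    define g where "g = (\<lambda>j. if j = m + 1 then [:0, 1:] else if j = i then [:[:0, 1:]:] else [:[:r j:]:])"
    \<comment> \<open>The expression along the plane \<open>x s z\<close>, as an element of \<open>K[s][z]\<close>.\<close>
    define lift where "lift S c = eval_terms (m + 1) S (\<lambda>\<alpha>. [:[:c \<alpha>:]:]) g" for S c
    have lift: "poly (poly (lift S c) [:z:]) s = eval_terms (m + 1) S c (x s z)" for S c s z
      unfolding lift_def poly2_eval_terms by (intro eval_terms_cong) (auto simp: g_def x_def)
    have r: "r \<in> affine_space (m + 1)" "r i = 0" "r (m + 1) = a"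
      using fix_r q i by (auto simp: affine_space_def PiE_def extensional_def)
    have rx: "x 0 a = r" using r by (auto simp: x_def)
    have rel: "of_nat (k i) * b * s ^ (k i - 1) * poly (poly (lift S1 c1) [:z:]) s
        + s ^ k i * poly (poly (lift S3 c3) [:z:]) s =
        poly (pderiv P) z * poly (poly (lift S2 c2) [:z:]) s"
      if sz: "b * s ^ k i = poly P z" for s z
    proof -
      have b: "(\<Prod>j\<in>{1..m}-{i}. x s z j ^ k j) = b"
        unfolding b_def by (intro prod.cong) (auto simp: x_def)
      have coords: "x s z i = s" "x s z (m + 1) = z" using i by (auto simp: x_def)
      have "x s z \<in> affine_space (m + 1)"
        using r i by (auto simp: x_def affine_space_def PiE_def extensional_def)
      moreover have "(\<Prod>j=1..m. x s z j ^ k j) = poly P z"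
        unfolding sz[symmetric] b[symmetric]
        by (subst prod.remove[of _ i]) (use i in \<open>auto simp: coords(1)\<close>)
      ultimately have xY: "x s z \<in> Y" unfolding power_product_variety_iff coords by blast
      have "u (x s z) = b" using xY b by (simp add: u_def)
      then show ?thesis
        using derived_equation(2)[OF i xY, folded u_def]
        unfolding v w u' restrict_apply'[OF xY] coords lift by simp
    qed
    have "degree P > 0" using degP by simp
    from tangent_to_axis_at_multiple_root[OF this a \<open>b \<noteq> 0\<close> k[OF i] rel]
    show ?thesis by (simp add: lift rx)
  qed
  have "eval_terms (m + 1) S1 c1 q = 0"
    by (rule eval_terms_eq_0_if_generic[of "{1..m} - {i}"], simp) (rule generic[THEN conjunct1])
  then show "D (coord i) q = 0" unfolding v restrict_apply'[OF qY] .
  have "eval_terms (m + 1) S2 c2 q = 0"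
    by (rule eval_terms_eq_0_if_generic[of "{1..m} - {i}"], simp) (rule generic[THEN conjunct2])
  then show "D (coord (m + 1)) q = 0" unfolding w restrict_apply'[OF qY] .
qed

text \<open>
  If \<open>z(t) = a\<close>, some \<open>y\<^sub>i\<close> vanishes at \<open>t\<close> as well. As \<open>D y\<^sub>i\<close> and \<open>D z\<close> vanish on the subspace \<open>y\<^sub>i = 0, z = a\<close>, the
  derivatives of \<open>y\<^sub>i\<close> and \<open>z - a\<close> along the orbit vanish at \<open>t\<close> at least to the order to which both
  functions vanish there. So this order is infinite, and \<open>z = a\<close> on the whole orbit, including its starting point.
\<close>
lemma orbit_avoids_multiple_root:
  assumes p: "p \<in> Y" "poly P (p (m + 1)) \<noteq> 0" and a: "poly P a = 0" "poly (pderiv P) a = 0"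
  shows "poly (orbit p (coord (m + 1))) t \<noteq> a"
proof
  let ?z = "orbit p (coord (m + 1))"
  assume t: "poly ?z t = a"
  have "poly (\<Prod>i=1..m. orbit p (coord i) ^ k i) t = 0"
    unfolding orbit_equation[OF p(1)] using t a by (simp add: poly_pcompose)
  then obtain i where i: "i \<in> {1..m}" and yt: "poly (orbit p (coord i)) t = 0"
    by (auto simp: poly_prod)
  let ?y = "orbit p (coord i)"
  have c: "coord i \<in> R" "coord (m + 1) \<in> R"
    by (rule coord_closed, use i in simp)+
  have step: "h dvd orbit p f"
    if f: "f \<in> R" and vanish: "\<And>q. q \<in> affine_space (m + 1) \<Longrightarrow> q i = 0 \<Longrightarrow> q (m + 1) = a \<Longrightarrow> f q = 0"
      and h: "h dvd ?y" "h dvd ?z - [:a:]" for f h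
  proof -
    obtain S c where f_eq: "f = (\<lambda>x\<in>Y. eval_terms (m + 1) S c x)"
      using f by (rule regular_functions_eval_termsE)
    \<comment> \<open>Compare the orbit with the curve obtained by moving it into the subspace, where \<open>f\<close> vanishes.\<close>
    define g where "g = (\<lambda>j. if j = i then 0 else if j = m + 1 then [:a:] else orbit p (coord j))"
    have "eval_terms (m + 1) S (\<lambda>\<alpha>. [:c \<alpha>:]) g = 0"
    proof -
      have "poly (eval_terms (m + 1) S (\<lambda>\<alpha>. [:c \<alpha>:]) g) s = 0" for s
      proof -
        define q where "q = (\<lambda>j\<in>{1..m+1}. poly (g j) s)"
        have q: "q \<in> affine_space (m + 1)" "q i = 0" "q (m + 1) = a"
          using i by (auto simp: q_def g_def affine_space_def)
        have "(\<Prod>j=1..m. q j ^ k j) = 0" using i q(2) k[OF i] by (intro prod_zero) auto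
        then have "q \<in> Y" using q a by (simp add: power_product_variety_iff)
        from vanish[OF q] have "eval_terms (m + 1) S c q = 0"
          unfolding f_eq restrict_apply'[OF \<open>q \<in> Y\<close>] .
        moreover have "eval_terms (m + 1) S c q = eval_terms (m + 1) S c (\<lambda>j. poly (g j) s)"
          by (rule eval_terms_cong) (simp add: q_def)
        ultimately show ?thesis by (simp add: poly_eval_terms)
      qed
      then show ?thesis using poly_all_0_iff_0 by blast
    qed
    moreover have "h dvd eval_terms (m + 1) S (\<lambda>\<alpha>. [:c \<alpha>:]) (\<lambda>j. orbit p (coord j))
        - eval_terms (m + 1) S (\<lambda>\<alpha>. [:c \<alpha>:]) g"
      by (rule eval_terms_dvd_diff) (use h in \<open>auto simp: g_def\<close>)
    ultimately show ?thesis unfolding f_eq orbit_eval_terms[OF p(1)] by simp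
  qed
  have "[:-t, 1:] ^ N dvd ?y \<and> [:-t, 1:] ^ N dvd ?z - [:a:]" for N
  proof (induction N)
    case (Suc N)
    note step' = step[OF D_closed _ Suc.IH[THEN conjunct1] Suc.IH[THEN conjunct2]]
    have "[:-t, 1:] ^ N dvd pderiv ?y"
      unfolding pderiv_orbit[OF p(1) c(1)]
      by (rule step'[OF c(1)], rule tangent_to_singular_divisor(1)[OF i a])
    moreover have "[:-t, 1:] ^ N dvd pderiv (?z - [:a:])"
      unfolding pderiv_diff pderiv_singleton diff_zero pderiv_orbit[OF p(1) c(2)]
      by (rule step'[OF c(2)], rule tangent_to_singular_divisor(2)[OF i a])
    moreover have "poly (?z - [:a:]) t = 0" using t by simp
    ultimately show ?case using yt linear_power_dvd_if_dvd_pderiv by blast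
  qed simp
  then have "[:-t, 1:] ^ Suc (order t (?z - [:a:])) dvd ?z - [:a:]" by blast
  then have "?z - [:a:] = 0" by (simp only: order_divides) simp
  then have "poly ?z 0 = a" by simp
  then have "p (m + 1) = a" using poly_orbit_0[OF p(1) c(2)] p(1) by simp
  with p(2) a show False by simp
qed

text \<open>
  The two cases, according to whether \<open>P\<close> has a multiple root, only differ in the reason why the \<open>z\<close>-coordinate is constant.
\<close>
lemma orbit_constant:
  assumes p: "p \<in> Y" "poly P (p (m + 1)) \<noteq> 0" and j: "j \<in> {1..m + 1}"
  shows "degree (orbit p (coord j)) = 0"
proof -
  let ?z = "orbit p (coord (m + 1))"
  have z: "degree ?z = 0"
  proof (cases "\<exists>a. poly P a = 0 \<and> poly (pderiv P) a = 0")
    case True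
    then obtain a where a: "poly P a = 0" "poly (pderiv P) a = 0" by blast
    have "degree (?z - [:a:]) = 0"
      using orbit_avoids_multiple_root[OF p a] alg_closed_imp_poly_has_root[of "?z - [:a:]"] by auto
    then obtain b where "?z - [:a:] = [:b:]" by (rule degree_eq_zeroE)
    then have "?z = [:b + a:]" by (simp add: diff_eq_eq)
    then show ?thesis by simp
  next
    case False
    then show ?thesis
      by (intro constant_if_product_of_powers[OF _ k orbit_equation[OF p(1)] degP]) auto
  qed
  then obtain b where b: "?z = [:b:]" by (rule degree_eq_zeroE)
  have "coord (m + 1) \<in> R" by (rule coord_closed) simp
  from poly_orbit_0[OF p(1) this] have "b = p (m + 1)" using b p(1) by simp
  then have prod: "(\<Prod>i=1..m. orbit p (coord i) ^ k i) = [:poly P (p (m + 1)):]"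
    unfolding orbit_equation[OF p(1)] b by (simp add: pcompose_pCons_0)
  have "degree (orbit p (coord j)) = 0" if "j \<in> {1..m}"
    by (rule constant_if_powers_constant[OF _ k_pos prod p(2) that]) simp_all
  with z j show ?thesis by (cases "j = m + 1") auto
qed

lemma derivation_eq_0:
  assumes f: "f \<in> R"
  shows "D f = (\<lambda>x\<in>Y. 0)"
proof -
  have generic: "D f p = 0" if p: "p \<in> Y" "poly P (p (m + 1)) \<noteq> 0" for p
  proof -
    have "poly (orbit p f) t = poly (orbit p f) 0" for t
    proof -
      have "flow p t = flow p 0"
        unfolding flow_def using orbit_constant[OF p]
        by (intro restrict_ext) (metis degree_eq_zeroE poly_const_conv)
      then show ?thesis
        using poly_orbit[OF p(1) f flow_in_variety[OF p(1)], of t]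
          poly_orbit[OF p(1) f flow_in_variety[OF p(1)], of 0] by simp
    qed
    then have "orbit p f = [:poly (orbit p f) 0:]"
      by (simp add: poly_eq_poly_eq_iff[symmetric] fun_eq_iff)
    then have "pderiv (orbit p f) = 0" by (metis pderiv_singleton)
    then show ?thesis
      using pderiv_orbit[OF p(1) f] poly_orbit_0[OF p(1) D_closed[OF f]] by simp
  qed
  have "D f q = 0" if "q \<in> Y" for q
    by (rule regular_function_eq_0_if_vanishes_generically[OF m _ k_pos D_closed[OF f] generic that])
      (use degP in simp_all)
  then show ?thesis
    using regular_functions_restrict[OF D_closed[OF f]] by (metis (no_types, lifting) restrict_ext)
qed

end

theorem lemma4p5:
  fixes P :: "'k::{alg_closed_field, field_char_0} poly"
    and m d :: nat
    and k :: "nat \<Rightarrow> nat"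
  assumes "m \<ge> 1"
    and "degree P = d" and "d \<ge> 2"
    and "\<And>i. i \<in> {1..m} \<Longrightarrow> k i \<ge> 2"
  shows "rigid (m + 1) (power_product_variety m k P)"
proof -
  let ?A = "regular_algebra (m + 1) (power_product_variety m k P)"
  have "D f = \<zero>\<^bsub>?A\<^esub>" if "derivation ?A D" "locally_nilpotent ?A D" "f \<in> carrier ?A" for D f
  proof -
    interpret derivation_of_power_product_variety m k P D
      by unfold_locales (use assms that in auto)
    show ?thesis using derivation_eq_0[of f] that(3) by (simp only: regular_algebra_def) simp
  qed
  then show ?thesis unfolding rigid_def by blast
qed

end
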